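(* Let $X$ be a centered Gaussian process with stationary increments and continuous trajectories, whose variance function $\sigma^2(t)=\mathrm{Var}(X(t))$ satisfies $\sigma(0)=0$ and $\sigma^2(t)>0$ for all $t>0$. Suppose that (A1) $\sigma^2(t)$ is regularly varying at $\infty$ with index $2\alpha_\infty\in(0,2]$ and is continuously differentiable on $(0,\infty)$ with derivative being ultimately monotone at $\infty$; (A2) $\sigma^2(t)$ is regularly varying at $0$ with index $2\alpha_0\in(0,2)$. Then for any positive $b$ and $S$ $$\lim_{T\to\infty}\mathcal{P}_X^b([0,S],[0,T])\in(0,\infty).$$
   Context: For positive constants $b,S,T$, $$\mathcal{P}_X^b([0,S],[0,T])=\mathbb{E}\left\{\sup_{t\in[0,T]}\inf_{s\in[0,S]}e^{\sqrt2X(t-s)-(1+b)\sigma^2(|t-s|)}\right\}.$$ Since $t-s$ may be negative, $X$ is understood as a process indexed by $\mathbb{R}$ with stationary increments, so that $\mathrm{Var}(X(t)-X(s))=\sigma^2(|t-s|)$ for all $s,t\in\mathbb{R}$ and $X(0)=0$. *)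

theory Defs
  imports "HOL-Probability.Probability"
begin

definition gaussian_rv :: "'a measure \<Rightarrow> ('a \<Rightarrow> real) \<Rightarrow> bool" where
  \<comment> \<open>Degenerate (almost surely constant) Gaussian laws are included; they have no density.\<close>
  "gaussian_rv M Y \<longleftrightarrow> Y \<in> borel_measurable M \<and>
     (\<exists>m. (AE \<omega> in M. Y \<omega> = m) \<or>
          (\<exists>s>0. distributed M lborel Y (\<lambda>x. ennreal (normal_density m s x))))"

definition gaussian_process :: "'a measure \<Rightarrow> (real \<Rightarrow> 'a \<Rightarrow> real) \<Rightarrow> bool" where
  "gaussian_process M X \<longleftrightarrow>
     (\<forall>J c. finite J \<longrightarrow> gaussian_rv M (\<lambda>\<omega>. \<Sum>t\<in>J. c t * X t \<omega>))"

definition centered :: "'a measure \<Rightarrow> (real \<Rightarrow> 'a \<Rightarrow> real) \<Rightarrow> bool" where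
  "centered M X \<longleftrightarrow> (\<forall>t. integrable M (X t) \<and> prob_space.expectation M (X t) = 0)"

definition stationary_increments :: "'a measure \<Rightarrow> (real \<Rightarrow> 'a \<Rightarrow> real) \<Rightarrow> bool" where
  \<comment> \<open>The finite-dimensional distributions of the increment process
      \<open>t \<mapsto> X (h + t) - X h\<close> do not depend on \<open>h\<close>.\<close>
  "stationary_increments M X \<longleftrightarrow>
     (\<forall>h J. finite J \<longrightarrow>
        distr M (\<Pi>\<^sub>M t\<in>J. borel) (\<lambda>\<omega>. \<lambda>t\<in>J. X (h + t) \<omega> - X h \<omega>) =
        distr M (\<Pi>\<^sub>M t\<in>J. borel) (\<lambda>\<omega>. \<lambda>t\<in>J. X t \<omega> - X 0 \<omega>))"

definition variance_fun :: "'a measure \<Rightarrow> (real \<Rightarrow> 'a \<Rightarrow> real) \<Rightarrow> real \<Rightarrow> real" where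
  "variance_fun M X t = prob_space.variance M (X t)"

definition regularly_varying_at_top :: "(real \<Rightarrow> real) \<Rightarrow> real \<Rightarrow> bool" where
  "regularly_varying_at_top f \<rho> \<longleftrightarrow>
     (\<exists>a. f \<in> borel_measurable (restrict_space borel {a..}) \<and> (\<forall>t\<ge>a. 0 < f t)) \<and>
     (\<forall>c>0. ((\<lambda>t. f (c * t) / f t) \<longlongrightarrow> c powr \<rho>) at_top)"

definition regularly_varying_at_zero :: "(real \<Rightarrow> real) \<Rightarrow> real \<Rightarrow> bool" where
  "regularly_varying_at_zero f \<rho> \<longleftrightarrow>
     (\<exists>a>0. f \<in> borel_measurable (restrict_space borel {0<..a}) \<and> (\<forall>t\<in>{0<..a}. 0 < f t)) \<and>
     (\<forall>c>0. ((\<lambda>t. f (c * t) / f t) \<longlongrightarrow> c powr \<rho>) (at_right 0))"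

definition ultimately_monotone :: "(real \<Rightarrow> real) \<Rightarrow> bool" where
  "ultimately_monotone f \<longleftrightarrow>
     (\<exists>a. monotone_on {a..} (\<le>) (\<le>) f \<or> monotone_on {a..} (\<le>) (\<ge>) f)"

definition piterbarg_const ::
    "'a measure \<Rightarrow> (real \<Rightarrow> 'a \<Rightarrow> real) \<Rightarrow> real \<Rightarrow> real set \<Rightarrow> real set \<Rightarrow> ennreal" where
  \<comment> \<open>Supremum, infimum and expectation are taken in \<open>[0, \<infinity>]\<close>, so that an infinite expectation
      has the value \<open>\<infinity>\<close>; a Bochner integral would give \<open>0\<close> there.\<close>
  "piterbarg_const M X b E F =
     (\<integral>\<^sup>+\<omega>. (SUP t\<in>F. INF s\<in>E.
        ennreal (exp (sqrt 2 * X (t - s) \<omega> - (1 + b) * variance_fun M X \<bar>t - s\<bar>))) \<partial>M)"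

end

theory Submission imports Defs begin

text \<open>
  Write \<open>v\<close> for the variance function. The truncated constants increase with \<open>T\<close>, so the limit is
  their supremum, and the point is that this supremum is finite and positive.

  For finiteness the infimum is bounded by its value at \<open>s = 0\<close>, and the half line is cut into unit
  intervals. On \<open>[k, k + 1]\<close> the path is at most \<open>X k\<close> plus the sum of its dyadic oscillations.
  Regular variation at \<open>0\<close> makes \<open>v(2\<^sup>-\<^sup>n)\<close> decay geometrically, so these oscillations have
  a finite total cost, and for every \<open>p > 1\<close> the exponential moment of \<open>\<surd>2 sup X\<close> over
  \<open>[k, k + 1]\<close> is at most \<open>exp(p v k + D)\<close> with \<open>D\<close> independent of \<open>k\<close>
  (\<open>exp_moment_unit_interval\<close>). The triangle inequality in \<open>L\<^sup>2\<close> shows that \<open>v t\<close> for \<open>t\<close> in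
  \<open>[k, k + 1]\<close> is at least almost \<open>v k\<close>, up to a constant (\<open>variance_le_of_increment\<close>). Since the
  drift has the coefficient \<open>1 + b > 1\<close>, choosing \<open>p\<close> close to \<open>1\<close> leaves a factor
  \<open>exp(- \<delta> v k)\<close> with \<open>\<delta> > 0\<close>. These factors are summable, because \<open>v\<close> is regularly varying at
  infinity with positive index and ultimately monotone
  (\<open>summable_exp_minus_regularly_varying\<close>).

  For positivity \<open>t = 0\<close> suffices: on the compact interval \<open>[0, S]\<close> the path is continuous and \<open>v\<close>
  is bounded, so the infimum over \<open>s\<close> is positive on every path
  (\<open>nn_integral_INF_drifted_pos\<close>).
\<close>

section \<open>Weighted exponentials and dyadic chaining\<close>

text \<open>
  Jensen's inequality for \<open>exp\<close>, in which the missing mass \<open>1 - (\<Sum>i\<in>I. w i)\<close> sits at the point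
  \<open>0\<close>. It splits the exponential of a chaining sum of dependent terms into a sum of exponentials.
\<close>

lemma exp_weighted_sum_le:
  fixes w x :: "'i \<Rightarrow> real"
  assumes "finite I" "\<And>i. i \<in> I \<Longrightarrow> 0 \<le> w i" "(\<Sum>i\<in>I. w i) \<le> 1"
  shows "exp (\<Sum>i\<in>I. w i * x i) \<le> (1 - (\<Sum>i\<in>I. w i)) + (\<Sum>i\<in>I. w i * exp (x i))"
proof -
  define y where "y = (\<Sum>i\<in>I. w i * x i)"
  define W where "W = (\<Sum>i\<in>I. w i)"
  \<comment> \<open>Every value of \<open>exp\<close> lies above the tangent line at the barycentre \<open>y\<close>.\<close>
  have tangent: "exp y * (1 + (z - y)) \<le> exp z" for z
  proof -
    have "exp y * (1 + (z - y)) \<le> exp y * exp (z - y)"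
      by (intro mult_left_mono exp_ge_add_one_self) auto
    then show ?thesis by (simp flip: exp_add)
  qed
  have "(\<Sum>i\<in>I. w i * (exp y * (1 + (x i - y)))) \<le> (\<Sum>i\<in>I. w i * exp (x i))"
    by (intro sum_mono mult_left_mono tangent assms)
  moreover have "(\<Sum>i\<in>I. w i * (exp y * (1 + (x i - y)))) = exp y * (W + y - y * W)"
  proof -
    have "(\<Sum>i\<in>I. w i * (exp y * (1 + (x i - y)))) = (\<Sum>i\<in>I. exp y * (w i + w i * x i - y * w i))"
      by (simp add: algebra_simps)
    also have "\<dots> = exp y * (W + y - y * W)"
      by (simp add: W_def y_def sum.distrib sum_subtractf flip: sum_distrib_left)
    finally show ?thesis .
  qed
  moreover have "(1 - W) * (exp y * (1 - y)) \<le> (1 - W) * 1"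
    using tangent[of 0] assms(3) by (intro mult_left_mono) (auto simp: W_def)
  ultimately show ?thesis
    unfolding y_def[symmetric] W_def[symmetric] by (simp add: algebra_simps)
qed

definition dyadic_osc :: "(real \<Rightarrow> real) \<Rightarrow> nat \<Rightarrow> real" where
  "dyadic_osc f n = (MAX j\<in>{..<2^n}. \<bar>f (real (Suc j) / 2^n) - f (real j / 2^n)\<bar>)"

lemma abs_diff_le_dyadic_osc:
  "j < 2^n \<Longrightarrow> \<bar>f (real (Suc j) / 2^n) - f (real j / 2^n)\<bar> \<le> dyadic_osc f n"
  unfolding dyadic_osc_def by (intro Max_ge) auto

lemma dyadic_osc_nonneg: "0 \<le> dyadic_osc f n"
  using abs_diff_le_dyadic_osc[of 0 n f] by simp

lemma exp_dyadic_osc_le: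
  fixes c :: real
  assumes "0 \<le> c"
  shows "exp (c * dyadic_osc f n) \<le>
    (\<Sum>j<2^n. exp (c * (f (real (Suc j) / 2^n) - f (real j / 2^n)))
             + exp (- c * (f (real (Suc j) / 2^n) - f (real j / 2^n))))"
proof -
  let ?d = "\<lambda>j. f (real (Suc j) / 2^n) - f (real j / 2^n)"
  have "dyadic_osc f n \<in> (\<lambda>j. \<bar>?d j\<bar>) ` {..<2^n}"
    unfolding dyadic_osc_def by (intro Max_in) (auto simp: lessThan_empty_iff)
  then obtain j where j: "j < 2^n" "dyadic_osc f n = \<bar>?d j\<bar>" by auto
  have "exp (c * \<bar>d\<bar>) \<le> exp (c * d) + exp (- c * d)" for d :: real
    by (cases "0 \<le> d") (simp_all add: add_increasing add_increasing2)
  then have "exp (c * dyadic_osc f n) \<le> exp (c * ?d j) + exp (- c * ?d j)"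
    unfolding j(2) .
  also have "\<dots> \<le> (\<Sum>j<2^n. exp (c * ?d j) + exp (- c * ?d j))"
    using j(1) by (intro member_le_sum) (auto intro: add_nonneg_nonneg)
  finally show ?thesis .
qed

text \<open>
  A dyadic point of level \<open>N\<close> with odd numerator has a left neighbour of level \<open>N - 1\<close>, and the step
  between them costs at most the oscillation of level \<open>N\<close>.
\<close>

lemma dyadic_chaining:
  "j \<le> 2^N \<Longrightarrow> f (real j / 2^N) \<le> f 0 + (\<Sum>n\<le>N. dyadic_osc f n)"
proof (induction N arbitrary: j)
  case 0
  then have "j = 0 \<or> j = 1" by auto
  then show ?case
    using abs_diff_le_dyadic_osc[of 0 0 f] dyadic_osc_nonneg[of f 0] by auto
next
  case (Suc N)
  have half: "f (real (2 * i) / 2 ^ Suc N) \<le> f 0 + (\<Sum>n\<le>N. dyadic_osc f n)" if "i \<le> 2^N" for i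
    using Suc.IH[OF that] by simp
  show ?case
  proof (cases "even j")
    case True
    then obtain i where "j = 2 * i" by blast
    with Suc.prems half[of i] dyadic_osc_nonneg[of f "Suc N"] show ?thesis by simp
  next
    case False
    then obtain i where i: "j = Suc (2 * i)" by (metis oddE Suc_eq_plus1)
    with Suc.prems have "i \<le> 2^N" "2 * i < 2^Suc N" by auto
    then show ?thesis
      using half[of i] abs_diff_le_dyadic_osc[of "2 * i" "Suc N" f]
      unfolding i by (simp add: abs_le_iff)
  qed
qed

lemma dyadic_approximation:
  fixes u :: real
  assumes "0 \<le> u" "u \<le> 1"
  obtains j where "\<And>N. j N \<le> 2^N" "(\<lambda>N. real (j N) / 2^N) \<longlonglongrightarrow> u"
proof
  let ?j = "\<lambda>N. nat \<lfloor>u * 2^N\<rfloor>"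
  have floor_nonneg: "0 \<le> \<lfloor>u * 2^N\<rfloor>" for N using assms by simp
  show "?j N \<le> 2^N" for N
  proof -
    have "u * 2^N \<le> 1 * 2^N" using assms by (intro mult_right_mono) auto
    then have "\<lfloor>u * 2^N\<rfloor> \<le> \<lfloor>of_int (2^N) :: real\<rfloor>" by (intro floor_mono) simp
    then show ?thesis by (simp only: floor_of_int nat_le_iff) simp
  qed
  show "(\<lambda>N. real (?j N) / 2^N) \<longlonglongrightarrow> u"
  proof (rule real_tendsto_sandwich)
    show "\<forall>\<^sub>F N in sequentially. u - (1/2)^N \<le> real (?j N) / 2^N"
    proof (rule always_eventually, rule allI)
      fix N
      have "u * 2^N - 1 \<le> real (?j N)" using floor_nonneg[of N] by linarith
      then have "(u * 2^N - 1) / 2^N \<le> real (?j N) / 2^N" by (intro divide_right_mono) auto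
      then show "u - (1/2)^N \<le> real (?j N) / 2^N" by (simp add: diff_divide_distrib power_divide)
    qed
    show "\<forall>\<^sub>F N in sequentially. real (?j N) / 2^N \<le> u"
    proof (rule always_eventually, rule allI)
      fix N
      have "real (?j N) \<le> u * 2^N" using floor_nonneg[of N] by linarith
      then show "real (?j N) / 2^N \<le> u" by (simp add: divide_le_eq)
    qed
    have "(\<lambda>N. (1/2::real)^N) \<longlonglongrightarrow> 0" by (intro LIMSEQ_power_zero) simp
    from tendsto_diff[OF tendsto_const this] show "(\<lambda>N. u - (1/2)^N) \<longlonglongrightarrow> u" by simp
  qed simp
qed

section \<open>Regular variation along powers of two\<close>

lemma geometric_bound_of_ratio:
  fixes a :: "nat \<Rightarrow> real"
  assumes pos: "\<And>n. 0 < a n" and "0 < r" and ev: "\<forall>\<^sub>F n in sequentially. a (Suc n) \<le> r * a n"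
  obtains C where "0 < C" "\<And>n. a n \<le> C * r^n"
proof -
  from ev obtain N where N: "\<And>n. n \<ge> N \<Longrightarrow> a (Suc n) \<le> r * a n"
    by (auto simp: eventually_sequentially)
  define C where "C = (\<Sum>i\<le>N. a i / r^i)"
  have "0 < C" unfolding C_def using pos \<open>0 < r\<close> by (intro sum_pos) auto
  moreover have "a n \<le> C * r^n" for n
  proof (induction n)
    case 0
    have "a 0 / r^0 \<le> C" unfolding C_def
      using pos \<open>0 < r\<close> by (intro member_le_sum) (auto intro: less_imp_le)
    then show ?case by simp
  next
    case (Suc n)
    show ?case
    proof (cases "n \<ge> N")
      case True
      have "a (Suc n) \<le> r * a n" by (rule N[OF True])
      also have "\<dots> \<le> r * (C * r^n)" using Suc \<open>0 < r\<close> by simp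
      finally show ?thesis by (simp add: ac_simps)
    next
      case False
      then have "a (Suc n) / r^Suc n \<le> C" unfolding C_def
        using pos \<open>0 < r\<close> by (intro member_le_sum[of "Suc n"]) (auto intro: less_imp_le)
      then show ?thesis using \<open>0 < r\<close> by (simp add: pos_divide_le_eq)
    qed
  qed
  ultimately show thesis by (rule that)
qed

text \<open>
  The rate at which the variances of the increments between neighbouring dyadic points decay with
  the level; it decides the convergence of the chaining sum.
\<close>

lemma regularly_varying_at_zero_geometric_bound:
  assumes rv: "regularly_varying_at_zero f \<rho>" and "0 < \<rho>" and pos: "\<And>t. 0 < t \<Longrightarrow> 0 < f t"
  obtains C r where "0 < C" "0 < r" "r < 1" "\<And>n. f (1 / 2^n) \<le> C * r^n"
proof -
  let ?k = "(1/2) powr \<rho> :: real"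
  have "?k < (1/2) powr 0" using \<open>0 < \<rho>\<close> by (intro powr_less_mono') auto
  then obtain r where r: "?k < r" "r < 1" using dense[of ?k 1] by auto
  have "0 < r" using r(1) by (rule le_less_trans[OF powr_ge_zero])
  have lim: "((\<lambda>t. f (1/2 * t) / f t) \<longlongrightarrow> ?k) (at_right 0)"
    using rv unfolding regularly_varying_at_zero_def by (auto dest!: conjunct2 spec[of _ "1/2"])
  have "filterlim (\<lambda>n. 1 / 2^n :: real) (at_right 0) sequentially"
  proof (rule tendsto_imp_filterlim_at_right)
    have "(\<lambda>n. (1/2 :: real)^n) \<longlonglongrightarrow> 0" by (intro LIMSEQ_power_zero) simp
    then show "(\<lambda>n. 1 / 2^n :: real) \<longlonglongrightarrow> 0" by (simp add: power_divide)
  qed simp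
  from filterlim_compose[OF lim this]
  have "\<forall>\<^sub>F n in sequentially. f (1/2 * (1 / 2^n)) / f (1 / 2^n) < r"
    using r(1) by (rule order_tendstoD)
  then have "\<forall>\<^sub>F n in sequentially. f (1 / 2^Suc n) \<le> r * f (1 / 2^n)"
    by eventually_elim (use pos in \<open>simp add: pos_divide_less_eq less_imp_le\<close>)
  then obtain C where "0 < C" "\<And>n. f (1 / 2^n) \<le> C * r^n"
    using geometric_bound_of_ratio[of "\<lambda>n. f (1 / 2^n)" r] pos \<open>0 < r\<close> by auto
  with \<open>0 < r\<close> r(2) show thesis by (intro that)
qed

lemma ultimately_monotone_deriv_cases:
  fixes f :: "real \<Rightarrow> real"
  assumes diff: "f differentiable_on {0<..}" and mono: "ultimately_monotone (deriv f)"
  obtains c where "0 < c" "(\<forall>x\<ge>c. \<forall>y\<ge>x. f x \<le> f y) \<or> (\<forall>x\<ge>c. \<forall>y\<ge>x. f y \<le> f x)"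
proof -
  obtain a where a: "monotone_on {a..} (\<le>) (\<le>) (deriv f) \<or> monotone_on {a..} (\<le>) (\<ge>) (deriv f)"
    using mono unfolding ultimately_monotone_def by blast
  have der: "DERIV f x :> deriv f x" if "0 < x" for x
  proof -
    have "f differentiable (at x)"
      using diff that by (auto simp: differentiable_on_def at_within_open[of _ "{0<..}"])
    then show ?thesis by (simp add: DERIV_deriv_iff_real_differentiable)
  qed
  \<comment> \<open>A monotone function has constant sign from some point on.\<close>
  have "\<exists>c. (\<forall>x\<ge>c. 0 \<le> deriv f x) \<or> (\<forall>x\<ge>c. deriv f x \<le> 0)"
    using a
  proof
    assume m: "monotone_on {a..} (\<le>) (\<le>) (deriv f)"
    show ?thesis
    proof (cases "\<exists>c\<ge>a. 0 < deriv f c")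
      case True
      then obtain c where "c \<ge> a" "0 < deriv f c" by blast
      then have "0 \<le> deriv f x" if "c \<le> x" for x using monotone_onD[OF m, of c x] that by simp
      then show ?thesis by blast
    next
      case False
      then show ?thesis by (meson not_less)
    qed
  next
    assume m: "monotone_on {a..} (\<le>) (\<ge>) (deriv f)"
    show ?thesis
    proof (cases "\<exists>c\<ge>a. deriv f c < 0")
      case True
      then obtain c where "c \<ge> a" "deriv f c < 0" by blast
      then have "deriv f x \<le> 0" if "c \<le> x" for x using monotone_onD[OF m, of c x] that by simp
      then show ?thesis by blast
    next
      case False
      then show ?thesis by (meson not_less)
    qed
  qed
  then obtain c where c: "(\<forall>x\<ge>c. 0 \<le> deriv f x) \<or> (\<forall>x\<ge>c. deriv f x \<le> 0)" by blast
  show thesis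
  proof (rule that[of "max c 1"])
    show "(\<forall>x\<ge>max c 1. \<forall>y\<ge>x. f x \<le> f y) \<or> (\<forall>x\<ge>max c 1. \<forall>y\<ge>x. f y \<le> f x)"
      using c
    proof
      assume sgn: "\<forall>x\<ge>c. 0 \<le> deriv f x"
      have "f x \<le> f y" if "max c 1 \<le> x" "x \<le> y" for x y
      proof (rule DERIV_nonneg_imp_nondecreasing[OF that(2)])
        fix z assume "x \<le> z" "z \<le> y"
        with that sgn have "DERIV f z :> deriv f z" "0 \<le> deriv f z" by (auto intro: der)
        then show "\<exists>d. DERIV f z :> d \<and> 0 \<le> d" by blast
      qed
      then show ?thesis by blast
    next
      assume sgn: "\<forall>x\<ge>c. deriv f x \<le> 0"
      have "f y \<le> f x" if "max c 1 \<le> x" "x \<le> y" for x y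
      proof (rule DERIV_nonpos_imp_nonincreasing[OF that(2)])
        fix z assume "x \<le> z" "z \<le> y"
        with that sgn have "DERIV f z :> deriv f z" "deriv f z \<le> 0" by (auto intro: der)
        then show "\<exists>d. DERIV f z :> d \<and> d \<le> 0" by blast
      qed
      then show ?thesis by blast
    qed
  qed simp
qed

lemma filterlim_power_at_top_gt1:
  fixes r :: real
  assumes "1 < r"
  shows "filterlim (\<lambda>n. r^n) at_top sequentially"
proof (rule filterlim_at_infinity_imp_filterlim_at_top)
  show "filterlim (\<lambda>n. r^n) at_infinity sequentially"
    using assms by (intro filterlim_realpow_sequentially_gt1) simp
  show "\<forall>\<^sub>F n in sequentially. 0 < r^n"
    using assms by (intro always_eventually allI zero_less_power) simp
qed

text \<open>
  Along powers of two a regularly varying function of positive index grows geometrically. The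
  monotone derivative is what carries this growth over to the integers in between: it makes the
  function itself ultimately monotone, and Cauchy condensation applies.
\<close>

lemma summable_exp_minus_regularly_varying:
  fixes f :: "real \<Rightarrow> real"
  assumes rv: "regularly_varying_at_top f \<rho>" and "0 < \<rho>" and pos: "\<And>t. 0 < t \<Longrightarrow> 0 < f t"
    and diff: "f differentiable_on {0<..}" and mono: "ultimately_monotone (deriv f)" and "0 < \<delta>"
  shows "summable (\<lambda>k. exp (- \<delta> * f (real k)))"
proof -
  let ?k = "2 powr \<rho> :: real"
  have "2 powr 0 < ?k" using \<open>0 < \<rho>\<close> by (intro powr_less_mono) auto
  then obtain r where r: "1 < r" "r < ?k" using dense[of 1 ?k] by auto
  have lim: "((\<lambda>t. f (2 * t) / f t) \<longlongrightarrow> ?k) at_top"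
    using rv unfolding regularly_varying_at_top_def by (auto dest!: conjunct2 spec[of _ 2])
  have pow: "filterlim (\<lambda>n. 2^n :: real) at_top sequentially"
    by (rule filterlim_power_at_top_gt1) simp
  from filterlim_compose[OF lim pow]
  have "\<forall>\<^sub>F n in sequentially. r < f (2 * 2^n) / f (2^n)"
    using r(2) by (rule order_tendstoD)
  then have ratio: "\<forall>\<^sub>F n in sequentially. r * f (2^n) \<le> f (2^Suc n)"
    by eventually_elim (use pos in \<open>simp add: pos_less_divide_eq less_imp_le\<close>)
  have "\<forall>\<^sub>F n in sequentially. inverse (f (2^Suc n)) \<le> (1/r) * inverse (f (2^n))"
    using ratio
  proof eventually_elim
    case (elim n)
    then show ?case using pos[of "2^n"] pos[of "2^Suc n"] r(1)
      by (simp add: field_simps)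
  qed
  then obtain C where C: "0 < C" "\<And>n. inverse (f (2^n)) \<le> C * (1/r)^n"
    using geometric_bound_of_ratio[of "\<lambda>n. inverse (f (2^n))" "1/r"] pos r(1) by auto
  have lower: "r^n / C \<le> f (2^n)" for n
    using C(2)[of n] C(1) pos[of "2^n"] r(1) by (simp add: field_simps power_divide)
  have "filterlim (\<lambda>n. r^n) at_top sequentially"
    by (rule filterlim_power_at_top_gt1) (use r in simp)
  then have r_top: "filterlim (\<lambda>n. (1/C) * r^n) at_top sequentially"
    using C(1) by (intro filterlim_tendsto_pos_mult_at_top[OF tendsto_const]) auto
  have f_top: "filterlim (\<lambda>n. f (2^n)) at_top sequentially"
    by (rule filterlim_at_top_mono[OF r_top]) (use lower in simp)

  obtain c where c: "0 < c" "(\<forall>x\<ge>c. \<forall>y\<ge>x. f x \<le> f y) \<or> (\<forall>x\<ge>c. \<forall>y\<ge>x. f y \<le> f x)"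
    using ultimately_monotone_deriv_cases[OF diff mono] by blast
  have incr: "f x \<le> f y" if "c \<le> x" "x \<le> y" for x y
  proof (rule ccontr)
    assume "\<not> f x \<le> f y"
    with c(2) that have anti: "\<forall>x\<ge>c. \<forall>y\<ge>x. f y \<le> f x" by blast
    have "\<forall>\<^sub>F n in sequentially. c \<le> 2^n" using pow by (auto simp: filterlim_at_top)
    moreover have "\<forall>\<^sub>F n in sequentially. f c + 1 \<le> f (2^n)"
      using f_top by (auto simp: filterlim_at_top)
    ultimately have "\<forall>\<^sub>F n :: nat in sequentially. False"
      by eventually_elim (use anti[rule_format, of c] in fastforce)
    then show False by simp
  qed

  define g where "g k = exp (- \<delta> * f (max c (real k)))" for k :: nat
  have "summable g"
  proof (subst condensation_test)
    show "g (Suc m) \<le> g m" for m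
      unfolding g_def using \<open>0 < \<delta>\<close> by (simp add: incr mult_left_mono)
    \<comment> \<open>The ratio test: consecutive values of \<open>f\<close> along powers of two differ by amounts that tend to
      infinity, and once such an amount exceeds \<open>ln 4 / \<delta>\<close> the condensed terms at least halve.\<close>
    have "\<forall>\<^sub>F n in sequentially. c \<le> 2^n" using pow by (auto simp: filterlim_at_top)
    moreover have "\<forall>\<^sub>F n in sequentially. ln 4 / (\<delta> * (r - 1)) \<le> f (2^n)"
      using f_top by (auto simp: filterlim_at_top)
    ultimately have "\<forall>\<^sub>F n in sequentially. norm (2^Suc n * g (2^Suc n)) \<le> 1/2 * norm (2^n * g (2^n))"
      using ratio
    proof eventually_elim
      case (elim n)
      have "c \<le> 2 * 2^n" using elim(1) by (rule order_trans) simp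
      have "ln 4 \<le> \<delta> * ((r - 1) * f (2^n))"
        using elim(2) \<open>0 < \<delta>\<close> r(1) by (simp add: pos_divide_le_eq ac_simps)
      also have "\<dots> \<le> \<delta> * (f (2^Suc n) - f (2^n))"
        using elim(3) \<open>0 < \<delta>\<close> by (intro mult_left_mono) (auto simp: algebra_simps)
      finally have "exp (- \<delta> * f (2^Suc n)) \<le> exp (- \<delta> * f (2^n) - ln 4)"
        by (simp add: algebra_simps)
      also have "\<dots> = exp (- \<delta> * f (2^n)) / 4" by (simp add: exp_diff)
      finally show ?case
        using elim(1) \<open>c \<le> 2 * 2^n\<close> by (simp add: g_def max_def norm_mult)
    qed
    then obtain N where "\<And>n. n \<ge> N \<Longrightarrow> norm (2^Suc n * g (2^Suc n)) \<le> 1/2 * norm (2^n * g (2^n))"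
      by (auto simp: eventually_sequentially)
    then show "summable (\<lambda>n. 2^n * g (2^n))"
      by (rule summable_ratio_test[rotated]) auto
  qed (auto simp: g_def)
  moreover have "\<forall>\<^sub>F k in sequentially. g k = exp (- \<delta> * f (real k))"
  proof -
    have "\<forall>\<^sub>F k in sequentially. c \<le> real k"
      using filterlim_real_sequentially by (auto simp: filterlim_at_top)
    then show ?thesis by eventually_elim (simp add: g_def max_def)
  qed
  ultimately show ?thesis using summable_cong[of g "\<lambda>k. exp (- \<delta> * f (real k))"] by blast
qed

section \<open>Exponential moments of suprema over unit intervals\<close>

text \<open>
  What the argument needs of the Gaussian law and of stationarity: the Laplace transforms and the
  second moments of the increments, which depend on the length of the increment alone.
\<close>

locale stationary_gaussian_increments = prob_space M for M :: "'a measure" +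
  fixes X :: "real \<Rightarrow> 'a \<Rightarrow> real" and v :: "real \<Rightarrow> real"
  assumes measurable_X [measurable]: "\<And>t. X t \<in> borel_measurable M"
    and continuous_path: "\<And>\<omega>. \<omega> \<in> space M \<Longrightarrow> continuous_on UNIV (\<lambda>t. X t \<omega>)"
    and X_0: "AE \<omega> in M. X 0 \<omega> = 0"
    and v_0: "v 0 = 0"
    and v_nonneg: "\<And>u. 0 \<le> u \<Longrightarrow> 0 \<le> v u"
    and mgf_increment: "\<And>h u l. 0 \<le> u \<Longrightarrow>
      (\<integral>\<^sup>+\<omega>. ennreal (exp (l * (X (h + u) \<omega> - X h \<omega>))) \<partial>M) = ennreal (exp (l\<^sup>2 * v u / 2))"
    and second_moment_increment: "\<And>h u. 0 \<le> u \<Longrightarrow>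
      (\<integral>\<^sup>+\<omega>. ennreal ((X (h + u) \<omega> - X h \<omega>)\<^sup>2) \<partial>M) = ennreal (v u)"
begin

lemma mgf:
  assumes "0 \<le> a"
  shows "(\<integral>\<^sup>+\<omega>. ennreal (exp (l * X a \<omega>)) \<partial>M) = ennreal (exp (l\<^sup>2 * v a / 2))"
proof -
  have "(\<integral>\<^sup>+\<omega>. ennreal (exp (l * X a \<omega>)) \<partial>M) = (\<integral>\<^sup>+\<omega>. ennreal (exp (l * (X (0 + a) \<omega> - X 0 \<omega>))) \<partial>M)"
    by (intro nn_integral_cong_AE) (use X_0 in eventually_elim, simp)
  also have "\<dots> = ennreal (exp (l\<^sup>2 * v a / 2))" by (rule mgf_increment[OF assms])
  finally show ?thesis .
qed

lemma second_moment:
  assumes "0 \<le> a"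
  shows "(\<integral>\<^sup>+\<omega>. ennreal ((X a \<omega>)\<^sup>2) \<partial>M) = ennreal (v a)"
proof -
  have "(\<integral>\<^sup>+\<omega>. ennreal ((X a \<omega>)\<^sup>2) \<partial>M) = (\<integral>\<^sup>+\<omega>. ennreal ((X (0 + a) \<omega> - X 0 \<omega>)\<^sup>2) \<partial>M)"
    by (intro nn_integral_cong_AE) (use X_0 in eventually_elim, simp)
  also have "\<dots> = ennreal (v a)" by (rule second_moment_increment[OF assms])
  finally show ?thesis .
qed

lemma measurable_dyadic_osc [measurable]:
  "(\<lambda>\<omega>. dyadic_osc (\<lambda>u. X (a + u) \<omega>) n) \<in> borel_measurable M"
  unfolding dyadic_osc_def by (intro borel_measurable_Max) auto

lemma mgf_dyadic_osc_le:
  assumes "0 \<le> l"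
  shows "(\<integral>\<^sup>+\<omega>. ennreal (exp (l * dyadic_osc (\<lambda>u. X (a + u) \<omega>) n)) \<partial>M)
    \<le> ennreal (2 ^ Suc n * exp (l\<^sup>2 * v (1 / 2^n) / 2))"
proof -
  let ?d = "\<lambda>j \<omega>. X (a + real (Suc j) / 2^n) \<omega> - X (a + real j / 2^n) \<omega>"
  let ?e = "exp (l\<^sup>2 * v (1 / 2^n) / 2)"
  have mgf_d: "(\<integral>\<^sup>+\<omega>. ennreal (exp (k * ?d j \<omega>)) \<partial>M) = ennreal (exp (k\<^sup>2 * v (1 / 2^n) / 2))" for j k
    using mgf_increment[of "1 / 2^n" k "a + real j / 2^n"] by (simp add: add_divide_distrib ac_simps)
  have "(\<integral>\<^sup>+\<omega>. ennreal (exp (l * dyadic_osc (\<lambda>u. X (a + u) \<omega>) n)) \<partial>M)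
    \<le> (\<integral>\<^sup>+\<omega>. (\<Sum>j<2^n. ennreal (exp (l * ?d j \<omega>)) + ennreal (exp (- l * ?d j \<omega>))) \<partial>M)"
  proof (rule nn_integral_mono)
    fix \<omega>
    have "ennreal (exp (l * dyadic_osc (\<lambda>u. X (a + u) \<omega>) n))
      \<le> ennreal (\<Sum>j<2^n. exp (l * ?d j \<omega>) + exp (- l * ?d j \<omega>))"
      by (rule ennreal_leI, rule exp_dyadic_osc_le[OF assms])
    also have "\<dots> = (\<Sum>j<2^n. ennreal (exp (l * ?d j \<omega>)) + ennreal (exp (- l * ?d j \<omega>)))"
      by (subst sum_ennreal[symmetric]) (auto intro: add_nonneg_nonneg)
    finally show "ennreal (exp (l * dyadic_osc (\<lambda>u. X (a + u) \<omega>) n))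
      \<le> (\<Sum>j<2^n. ennreal (exp (l * ?d j \<omega>)) + ennreal (exp (- l * ?d j \<omega>)))" .
  qed
  also have "\<dots> = (\<Sum>j<2^n::nat. (\<integral>\<^sup>+\<omega>. ennreal (exp (l * ?d j \<omega>)) \<partial>M)
                            + (\<integral>\<^sup>+\<omega>. ennreal (exp (- l * ?d j \<omega>)) \<partial>M))"
    by (subst nn_integral_sum) (auto intro!: sum.cong nn_integral_add)
  also have "\<dots> = (\<Sum>j<2^n::nat. ennreal (2 * ?e))"
    unfolding mgf_d by (simp flip: ennreal_plus)
  also have "\<dots> = ennreal (\<Sum>j<2^n::nat. 2 * ?e)"
    by (rule sum_ennreal) simp
  also have "(\<Sum>j<2^n::nat. 2 * ?e) = 2 ^ Suc n * ?e"
    by simp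
  finally show ?thesis .
qed

text \<open>
  The chaining sum \<open>X a + (\<Sum>n. M\<^sub>n)\<close>, with \<open>M\<^sub>n\<close> the dyadic oscillation of level \<open>n\<close>, dominates the
  path on the unit interval. Jensen's inequality with weight \<open>1 / p\<close> on \<open>X a\<close> and weights
  proportional to \<open>\<rho>\<^sup>n\<close>, \<open>\<rho> = \<surd>r\<close>, on the \<open>M\<^sub>n\<close> reduces its exponential moment to those of the single
  terms \<open>\<surd>2 p X a\<close> and \<open>\<surd>2 M\<^sub>n / w\<^sub>n\<close>. Each of these is first lowered by the logarithm of a bound on
  its exponential moment; for level \<open>n\<close> this logarithm, \<open>(n + 1) ln 2 + v(2\<^sup>-\<^sup>n) / w\<^sub>n\<^sup>2\<close>, is
  unbounded in \<open>n\<close> but summable against the weights.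
  The weight \<open>1 / p\<close> is what makes the coefficient of \<open>v a\<close> in the bound equal to \<open>p\<close>, as close to
  \<open>1\<close> as desired.
\<close>

lemma exp_moment_unit_interval:
  assumes r: "0 < r" "r < 1" and geom: "\<And>n. v (1 / 2^n) \<le> C * r^n" and p: "1 < p"
  obtains D where "\<And>a. 0 \<le> a \<Longrightarrow> \<exists>F\<in>borel_measurable M.
      (\<forall>\<omega>\<in>space M. \<forall>t\<in>{a..a+1}. ennreal (exp (sqrt 2 * X t \<omega>)) \<le> F \<omega>) \<and>
      (\<integral>\<^sup>+\<omega>. F \<omega> \<partial>M) \<le> ennreal (exp (p * v a + D))"
proof -
  define \<rho> where "\<rho> = sqrt r"
  have \<rho>: "0 < \<rho>" "\<rho> < 1" "r = \<rho> * \<rho>" using r by (auto simp: \<rho>_def)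
  define c where "c = (1 - 1/p) * (1 - \<rho>)"
  have "0 < c" using p \<rho> by (simp add: c_def)
  define w where "w n = c * \<rho>^n" for n
  have w_pos: "0 < w n" for n using \<open>0 < c\<close> \<rho> by (simp add: w_def)
  have w_sum: "(\<Sum>n\<le>N. w n) \<le> 1 - 1/p" for N
  proof -
    have "(\<Sum>n\<le>N. w n) \<le> (\<Sum>n. w n)"
      using \<rho> w_pos unfolding w_def
      by (intro sum_le_suminf summable_mult summable_geometric) (auto intro: less_imp_le)
    also have "\<dots> = 1 - 1/p"
      using \<rho> by (simp add: w_def suminf_mult summable_geometric suminf_geometric c_def)
    finally show ?thesis .
  qed
  define cost where "cost n = real (Suc n) * ln 2 + v (1 / 2^n) / (w n)\<^sup>2" for n
  define B where "B n = c * ln 2 * (real (Suc n) * \<rho>^n) + C / c * \<rho>^n" for n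
  have B_summable: "summable B"
    unfolding B_def using \<rho> geometric_deriv_sums[of \<rho>]
    by (intro summable_add summable_mult summable_geometric) (auto simp: sums_iff)
  have cost_le: "w n * cost n \<le> B n" for n
  proof -
    have "v (1 / 2^n) / w n \<le> C * r^n / w n"
      using w_pos[of n] by (intro divide_right_mono geom) auto
    also have "\<dots> = C / c * \<rho>^n"
      using \<rho> \<open>0 < c\<close> by (simp add: w_def power_mult_distrib)
    finally have "v (1 / 2^n) / w n \<le> C / c * \<rho>^n" .
    moreover have "w n * cost n = c * ln 2 * (real (Suc n) * \<rho>^n) + v (1 / 2^n) / w n"
      using w_pos[of n] by (simp add: cost_def w_def distrib_left power2_eq_square)
    ultimately show ?thesis by (simp add: B_def)
  qed
  have cost_nonneg: "0 \<le> cost n" for n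
    by (auto simp: cost_def intro!: add_nonneg_nonneg mult_nonneg_nonneg divide_nonneg_nonneg v_nonneg)
  have B_nonneg: "0 \<le> B n" for n
    using cost_le[of n] cost_nonneg[of n] w_pos[of n] by (meson less_imp_le mult_nonneg_nonneg order_trans)
  define D where "D = suminf B"
  have cost_sum: "(\<Sum>n\<le>N. w n * cost n) \<le> D" for N
  proof -
    have "(\<Sum>n\<le>N. w n * cost n) \<le> (\<Sum>n\<le>N. B n)" by (intro sum_mono cost_le)
    also have "\<dots> \<le> D" unfolding D_def using B_summable B_nonneg by (intro sum_le_suminf) auto
    finally show ?thesis .
  qed
  show thesis
  proof (rule that)
    fix a :: real assume a: "0 \<le> a"
    define osc where "osc n \<omega> = dyadic_osc (\<lambda>u. X (a + u) \<omega>) n" for n \<omega>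
    have [measurable]: "osc n \<in> borel_measurable M" for n
      unfolding osc_def by measurable
    have osc_nonneg: "0 \<le> osc n \<omega>" for n \<omega> by (simp add: osc_def dyadic_osc_nonneg)
    define G where "G N \<omega> = exp (sqrt 2 * (X a \<omega> + (\<Sum>n\<le>N. osc n \<omega>)))" for N \<omega>
    have [measurable]: "G N \<in> borel_measurable M" for N unfolding G_def by measurable
    define F where "F \<omega> = (SUP N. ennreal (G N \<omega>))" for \<omega>
    have [measurable]: "F \<in> borel_measurable M" unfolding F_def by measurable

    let ?K = "p * v a + D"
    define W where "W = case_nat (1/p) w"
    define Y where
      "Y \<omega> = case_nat (sqrt 2 * p * X a \<omega> - p\<^sup>2 * v a) (\<lambda>n. sqrt 2 / w n * osc n \<omega> - cost n)" for \<omega>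
    have [measurable]: "(\<lambda>\<omega>. Y \<omega> i) \<in> borel_measurable M" for i
      unfolding Y_def by (cases i) auto
    have W_nonneg: "0 \<le> W i" for i using w_pos p by (cases i) (auto simp: W_def less_imp_le)
    have W_sum: "(\<Sum>i\<le>Suc N. W i) \<le> 1" for N
      using w_sum[of N] by (simp add: W_def sum.atMost_Suc_shift del: sum.atMost_Suc)
    have exp_Y: "(\<integral>\<^sup>+\<omega>. ennreal (exp (Y \<omega> i)) \<partial>M) \<le> 1" for i
    proof (cases i)
      case 0
      have "(\<integral>\<^sup>+\<omega>. ennreal (exp (Y \<omega> i)) \<partial>M)
        = (\<integral>\<^sup>+\<omega>. ennreal (exp (- (p\<^sup>2 * v a))) * ennreal (exp (sqrt 2 * p * X a \<omega>)) \<partial>M)"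
        unfolding 0 Y_def by (simp add: exp_diff exp_minus divide_inverse mult.commute flip: ennreal_mult')
      also have "\<dots> = ennreal (exp (- (p\<^sup>2 * v a))) * ennreal (exp (p\<^sup>2 * v a))"
        by (subst nn_integral_cmult) (auto simp: mgf[OF a] power_mult_distrib)
      also have "\<dots> = 1" by (simp flip: ennreal_mult' exp_add)
      finally show ?thesis by simp
    next
      case (Suc n)
      have "(\<integral>\<^sup>+\<omega>. ennreal (exp (Y \<omega> i)) \<partial>M)
        = (\<integral>\<^sup>+\<omega>. ennreal (exp (- cost n)) * ennreal (exp (sqrt 2 / w n * osc n \<omega>)) \<partial>M)"
        unfolding Suc Y_def by (simp add: exp_diff exp_minus divide_inverse mult.commute flip: ennreal_mult')
      also have "\<dots> = ennreal (exp (- cost n)) * (\<integral>\<^sup>+\<omega>. ennreal (exp (sqrt 2 / w n * osc n \<omega>)) \<partial>M)"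
        by (rule nn_integral_cmult) measurable
      also have "\<dots> \<le> ennreal (exp (- cost n)) *
          ennreal (2 ^ Suc n * exp ((sqrt 2 / w n)\<^sup>2 * v (1 / 2^n) / 2))"
        unfolding osc_def using w_pos[of n] by (intro mult_left_mono mgf_dyadic_osc_le) auto
      also have "2 ^ Suc n * exp ((sqrt 2 / w n)\<^sup>2 * v (1 / 2^n) / 2) = exp (cost n)"
      proof -
        have "(2::real) ^ Suc n = exp (real (Suc n) * ln 2)" by (subst exp_of_nat_mult) simp
        then show ?thesis by (simp add: cost_def exp_add power_divide del: power_Suc of_nat_Suc)
      qed
      also have "ennreal (exp (- cost n)) * ennreal (exp (cost n)) = 1"
        by (simp flip: ennreal_mult' exp_add)
      finally show ?thesis .
    qed
    have G_le: "G N \<omega> \<le> exp ?K * ((1 - (\<Sum>i\<le>Suc N. W i)) + (\<Sum>i\<le>Suc N. W i * exp (Y \<omega> i)))" for N \<omega>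
    proof -
      have "w n * (sqrt 2 / w n * osc n \<omega> - cost n) = sqrt 2 * osc n \<omega> - w n * cost n" for n
        using w_pos[of n] by (simp add: right_diff_distrib)
      then have "(\<Sum>i\<le>Suc N. W i * Y \<omega> i)
          = 1/p * (sqrt 2 * p * X a \<omega> - p\<^sup>2 * v a) + (\<Sum>n\<le>N. sqrt 2 * osc n \<omega> - w n * cost n)"
        by (simp add: W_def Y_def sum.atMost_Suc_shift del: sum.atMost_Suc)
      also have "1/p * (sqrt 2 * p * X a \<omega> - p\<^sup>2 * v a) = sqrt 2 * X a \<omega> - p * v a"
        using p by (simp add: field_simps power2_eq_square)
      finally have "sqrt 2 * (X a \<omega> + (\<Sum>n\<le>N. osc n \<omega>)) \<le> ?K + (\<Sum>i\<le>Suc N. W i * Y \<omega> i)"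
        using cost_sum[of N] by (simp add: sum_subtractf sum_distrib_left distrib_left)
      then have "G N \<omega> \<le> exp ?K * exp (\<Sum>i\<le>Suc N. W i * Y \<omega> i)"
        by (simp add: G_def flip: exp_add)
      also have "\<dots> \<le> exp ?K * ((1 - (\<Sum>i\<le>Suc N. W i)) + (\<Sum>i\<le>Suc N. W i * exp (Y \<omega> i)))"
        using W_nonneg W_sum by (intro mult_left_mono exp_weighted_sum_le) auto
      finally show ?thesis .
    qed
    have int_G: "(\<integral>\<^sup>+\<omega>. ennreal (G N \<omega>) \<partial>M) \<le> ennreal (exp ?K)" for N
    proof -
      let ?W = "\<Sum>i\<le>Suc N. W i"
      have "(\<integral>\<^sup>+\<omega>. ennreal (G N \<omega>) \<partial>M) \<le> (\<integral>\<^sup>+\<omega>. ennreal (exp ?K) *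
          (ennreal (1 - ?W) + (\<Sum>i\<le>Suc N. ennreal (W i) * ennreal (exp (Y \<omega> i)))) \<partial>M)"
      proof (rule nn_integral_mono)
        fix \<omega>
        have "(\<Sum>i\<le>Suc N. ennreal (W i) * ennreal (exp (Y \<omega> i))) = ennreal (\<Sum>i\<le>Suc N. W i * exp (Y \<omega> i))"
          using W_nonneg by (subst sum_ennreal[symmetric]) (auto simp: ennreal_mult simp del: sum.atMost_Suc)
        moreover have "0 \<le> (\<Sum>i\<le>Suc N. W i * exp (Y \<omega> i))"
          using W_nonneg by (intro sum_nonneg) auto
        ultimately have "ennreal (exp ?K) *
            (ennreal (1 - ?W) + (\<Sum>i\<le>Suc N. ennreal (W i) * ennreal (exp (Y \<omega> i))))
          = ennreal (exp ?K * ((1 - ?W) + (\<Sum>i\<le>Suc N. W i * exp (Y \<omega> i))))"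
          using W_sum[of N] by (simp only: ennreal_mult' ennreal_plus exp_ge_zero diff_ge_0_iff_ge)
        then show "ennreal (G N \<omega>) \<le> ennreal (exp ?K) *
            (ennreal (1 - ?W) + (\<Sum>i\<le>Suc N. ennreal (W i) * ennreal (exp (Y \<omega> i))))"
          using ennreal_leI[OF G_le[of N \<omega>]] by simp
      qed
      also have "\<dots> = ennreal (exp ?K) *
          (ennreal (1 - ?W) + (\<Sum>i\<le>Suc N. ennreal (W i) * (\<integral>\<^sup>+\<omega>. ennreal (exp (Y \<omega> i)) \<partial>M)))"
        by (simp add: nn_integral_cmult nn_integral_add nn_integral_sum emeasure_space_1
              del: sum.atMost_Suc)
      also have "\<dots> \<le> ennreal (exp ?K) * (ennreal (1 - ?W) + (\<Sum>i\<le>Suc N. ennreal (W i) * 1))"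
        by (intro mult_left_mono add_left_mono sum_mono exp_Y) auto
      also have "\<dots> = ennreal (exp ?K)"
        using W_nonneg W_sum[of N]
        by (simp add: sum_ennreal sum_nonneg flip: ennreal_plus del: sum.atMost_Suc)
      finally show ?thesis .
    qed
    have "incseq (\<lambda>N \<omega>. ennreal (G N \<omega>))"
      by (intro incseq_SucI le_funI ennreal_leI) (simp add: G_def osc_nonneg)
    then have "(\<integral>\<^sup>+\<omega>. F \<omega> \<partial>M) = (SUP N. \<integral>\<^sup>+\<omega>. ennreal (G N \<omega>) \<partial>M)"
      unfolding F_def by (intro nn_integral_monotone_convergence_SUP) measurable
    also have "\<dots> \<le> ennreal (exp ?K)" by (intro SUP_least int_G)
    finally have int_F: "(\<integral>\<^sup>+\<omega>. F \<omega> \<partial>M) \<le> ennreal (exp ?K)" .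
    have F_dominates: "ennreal (exp (sqrt 2 * X t \<omega>)) \<le> F \<omega>"
      if \<omega>: "\<omega> \<in> space M" and t: "t \<in> {a..a+1}" for \<omega> t
    proof -
      obtain j where j: "\<And>N. j N \<le> 2^N" "(\<lambda>N. real (j N) / 2^N) \<longlonglongrightarrow> t - a"
        using dyadic_approximation[of "t - a"] t by auto
      have "(\<lambda>N. a + real (j N) / 2^N) \<longlonglongrightarrow> a + (t - a)"
        by (intro tendsto_add tendsto_const j(2))
      moreover have "isCont (\<lambda>t. X t \<omega>) t"
        using continuous_path[OF \<omega>] by (simp add: continuous_on_eq_continuous_at)
      ultimately have "(\<lambda>N. X (a + real (j N) / 2^N) \<omega>) \<longlonglongrightarrow> X t \<omega>"
        by (intro isCont_tendsto_compose[of t "\<lambda>t. X t \<omega>"]) auto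
      then have "(\<lambda>N. ennreal (exp (sqrt 2 * X (a + real (j N) / 2^N) \<omega>))) \<longlonglongrightarrow> ennreal (exp (sqrt 2 * X t \<omega>))"
        by (intro tendsto_ennrealI tendsto_exp tendsto_mult tendsto_const)
      moreover have "ennreal (exp (sqrt 2 * X (a + real (j N) / 2^N) \<omega>)) \<le> F \<omega>" for N
      proof -
        have "exp (sqrt 2 * X (a + real (j N) / 2^N) \<omega>) \<le> G N \<omega>"
          using dyadic_chaining[OF j(1), of "\<lambda>u. X (a + u) \<omega>"] by (simp add: G_def osc_def)
        then show ?thesis unfolding F_def by (intro SUP_upper2[of N] ennreal_leI) auto
      qed
      ultimately show ?thesis by (meson LIMSEQ_le_const2)
    qed
    show "\<exists>F\<in>borel_measurable M.
      (\<forall>\<omega>\<in>space M. \<forall>t\<in>{a..a+1}. ennreal (exp (sqrt 2 * X t \<omega>)) \<le> F \<omega>) \<and>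
      (\<integral>\<^sup>+\<omega>. F \<omega> \<partial>M) \<le> ennreal (exp ?K)"
      using F_dominates int_F by (intro bexI[of _ F]) auto
  qed
qed

section \<open>Finiteness and positivity of the supremum\<close>

text \<open>
  The variance at \<open>t\<close> is the logarithm of the exponential moment of \<open>\<surd>2 X t\<close>, which the moment of the
  supremum dominates.
\<close>

lemma variance_le_on_unit_interval:
  assumes r: "0 < r" "r < 1" and geom: "\<And>n. v (1 / 2^n) \<le> C * r^n"
  obtains K where "0 \<le> K" "\<And>a t. 0 \<le> a \<Longrightarrow> t \<in> {a..a+1} \<Longrightarrow> v t \<le> 2 * v a + K"
proof -
  obtain D where D: "\<And>a. 0 \<le> a \<Longrightarrow> \<exists>F\<in>borel_measurable M.
      (\<forall>\<omega>\<in>space M. \<forall>t\<in>{a..a+1}. ennreal (exp (sqrt 2 * X t \<omega>)) \<le> F \<omega>) \<and>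
      (\<integral>\<^sup>+\<omega>. F \<omega> \<partial>M) \<le> ennreal (exp (2 * v a + D))"
    using exp_moment_unit_interval[OF r geom, of 2] by auto
  have bound: "v t \<le> 2 * v a + D" if "0 \<le> a" "t \<in> {a..a+1}" for a t
  proof -
    obtain F where F: "\<And>\<omega>. \<omega> \<in> space M \<Longrightarrow> ennreal (exp (sqrt 2 * X t \<omega>)) \<le> F \<omega>"
      "(\<integral>\<^sup>+\<omega>. F \<omega> \<partial>M) \<le> ennreal (exp (2 * v a + D))"
      using D[OF \<open>0 \<le> a\<close>] \<open>t \<in> {a..a+1}\<close> by blast
    have "ennreal (exp (v t)) = (\<integral>\<^sup>+\<omega>. ennreal (exp (sqrt 2 * X t \<omega>)) \<partial>M)"
      using that by (subst mgf) auto
    also have "\<dots> \<le> (\<integral>\<^sup>+\<omega>. F \<omega> \<partial>M)" by (intro nn_integral_mono F(1))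
    also note F(2)
    finally show ?thesis by simp
  qed
  moreover have "0 \<le> D" using bound[of 0 0] by (simp add: v_0)
  ultimately show thesis using that by blast
qed

lemma variance_le_of_increment:
  assumes "0 \<le> a" "a \<le> t" "0 < \<epsilon>"
  shows "v a \<le> (1 + \<epsilon>) * v t + (1 + 1/\<epsilon>) * v (t - a)"
proof -
  have young: "(x - y)\<^sup>2 \<le> (1 + \<epsilon>) * x\<^sup>2 + (1 + 1/\<epsilon>) * y\<^sup>2" for x y :: real
  proof -
    have "0 \<le> (\<epsilon> * x + y)\<^sup>2 / \<epsilon>" using \<open>0 < \<epsilon>\<close> by simp
    also have "\<dots> = \<epsilon> * x\<^sup>2 + 2 * x * y + 1/\<epsilon> * y\<^sup>2"
      using \<open>0 < \<epsilon>\<close> by (simp add: field_simps power2_eq_square)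
    finally show ?thesis by (simp add: power2_eq_square algebra_simps)
  qed
  have "ennreal (v a) = (\<integral>\<^sup>+\<omega>. ennreal ((X a \<omega>)\<^sup>2) \<partial>M)"
    using assms by (simp add: second_moment)
  also have "\<dots> \<le> (\<integral>\<^sup>+\<omega>. ennreal (1 + \<epsilon>) * ennreal ((X t \<omega>)\<^sup>2)
      + ennreal (1 + 1/\<epsilon>) * ennreal ((X (a + (t - a)) \<omega> - X a \<omega>)\<^sup>2) \<partial>M)"
  proof (rule nn_integral_mono)
    fix \<omega>
    have "ennreal ((X a \<omega>)\<^sup>2) \<le> ennreal ((1 + \<epsilon>) * (X t \<omega>)\<^sup>2 + (1 + 1/\<epsilon>) * (X t \<omega> - X a \<omega>)\<^sup>2)"
      using young[of "X t \<omega>" "X t \<omega> - X a \<omega>"] by (intro ennreal_leI) simp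
    also have "\<dots> = ennreal (1 + \<epsilon>) * ennreal ((X t \<omega>)\<^sup>2)
        + ennreal (1 + 1/\<epsilon>) * ennreal ((X (a + (t - a)) \<omega> - X a \<omega>)\<^sup>2)"
      using \<open>0 < \<epsilon>\<close> by (simp add: ennreal_plus ennreal_mult del: ennreal_plus[symmetric])
    finally show "ennreal ((X a \<omega>)\<^sup>2) \<le> ennreal (1 + \<epsilon>) * ennreal ((X t \<omega>)\<^sup>2)
        + ennreal (1 + 1/\<epsilon>) * ennreal ((X (a + (t - a)) \<omega> - X a \<omega>)\<^sup>2)" .
  qed
  also have "\<dots> = ennreal (1 + \<epsilon>) * ennreal (v t) + ennreal (1 + 1/\<epsilon>) * ennreal (v (t - a))"
    using assms second_moment[of t] second_moment_increment[of "t - a" a]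
    by (simp add: nn_integral_add nn_integral_cmult)
  also have "\<dots> = ennreal ((1 + \<epsilon>) * v t + (1 + 1/\<epsilon>) * v (t - a))"
    using assms v_nonneg[of t] v_nonneg[of "t - a"] by (simp add: ennreal_plus ennreal_mult)
  finally show ?thesis
    using assms v_nonneg[of t] v_nonneg[of "t - a"]
    by (subst (asm) ennreal_le_iff) auto
qed

text \<open>
  On \<open>[k, k + 1]\<close> the exponential moment is at most \<open>exp(p v k + D)\<close>, while the drift \<open>(1 + b) v t\<close>
  exceeds \<open>(p + \<delta>) v k\<close> up to a constant. Here \<open>1 + b\<close> is shared out as \<open>p = 1 + b/3\<close>, \<open>\<delta> = b/3\<close>
  and a factor \<open>1 + \<epsilon>\<close> that pays for replacing \<open>v t\<close> by \<open>v k\<close>.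
\<close>

lemma nn_integral_SUP_drifted_finite:
  assumes r: "0 < r" "r < 1" and geom: "\<And>n. v (1 / 2^n) \<le> C * r^n"
    and summ: "\<And>\<delta>. 0 < \<delta> \<Longrightarrow> summable (\<lambda>k. exp (- \<delta> * v (real k)))" and "0 < b"
  shows "(\<integral>\<^sup>+\<omega>. (SUP t\<in>{0..}. ennreal (exp (sqrt 2 * X t \<omega> - (1 + b) * v t))) \<partial>M) < \<infinity>"
proof -
  define p where "p = 1 + b/3"
  define \<delta> where "\<delta> = b/3"
  define \<epsilon> where "\<epsilon> = (1 + b) / (p + \<delta>) - 1"
  have params: "1 < p" "0 < \<delta>" "0 < p + \<delta>" "0 < \<epsilon>" "1 + b = (p + \<delta>) * (1 + \<epsilon>)"
    using \<open>0 < b\<close> by (auto simp: p_def \<delta>_def \<epsilon>_def field_simps)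
  obtain D where D: "\<And>a. 0 \<le> a \<Longrightarrow> \<exists>F\<in>borel_measurable M.
      (\<forall>\<omega>\<in>space M. \<forall>t\<in>{a..a+1}. ennreal (exp (sqrt 2 * X t \<omega>)) \<le> F \<omega>) \<and>
      (\<integral>\<^sup>+\<omega>. F \<omega> \<partial>M) \<le> ennreal (exp (p * v a + D))"
    using exp_moment_unit_interval[OF r geom params(1)] by blast
  have "\<forall>k::nat. \<exists>F. F \<in> borel_measurable M \<and>
      (\<forall>\<omega>\<in>space M. \<forall>t\<in>{real k..real k + 1}. ennreal (exp (sqrt 2 * X t \<omega>)) \<le> F \<omega>) \<and>
      (\<integral>\<^sup>+\<omega>. F \<omega> \<partial>M) \<le> ennreal (exp (p * v (real k) + D))"
    using D by (meson of_nat_0_le_iff)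
  then obtain F :: "nat \<Rightarrow> 'a \<Rightarrow> ennreal" where F_meas [measurable]: "\<And>k. F k \<in> borel_measurable M"
    and F: "\<And>k \<omega> t. \<omega> \<in> space M \<Longrightarrow> t \<in> {real k..real k + 1} \<Longrightarrow> ennreal (exp (sqrt 2 * X t \<omega>)) \<le> F k \<omega>"
    and int_F: "\<And>k. (\<integral>\<^sup>+\<omega>. F k \<omega> \<partial>M) \<le> ennreal (exp (p * v (real k) + D))"
    by metis
  obtain K where K: "0 \<le> K" "\<And>a t. 0 \<le> a \<Longrightarrow> t \<in> {a..a+1} \<Longrightarrow> v t \<le> 2 * v a + K"
    using variance_le_on_unit_interval[OF r geom] by blast
  define e where "e k = exp ((p + \<delta>) * ((1 + 1/\<epsilon>) * K) - (p + \<delta>) * v (real k))" for k :: nat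
  have drift: "exp (- ((1 + b) * v t)) \<le> e k" if "t \<in> {real k..real k + 1}" for k t
  proof -
    have "v (real k) \<le> (1 + \<epsilon>) * v t + (1 + 1/\<epsilon>) * v (t - real k)"
      using that params by (intro variance_le_of_increment) auto
    also have "\<dots> \<le> (1 + \<epsilon>) * v t + (1 + 1/\<epsilon>) * K"
      using K(2)[of 0 "t - real k"] that params by (intro add_left_mono mult_left_mono) (auto simp: v_0)
    finally have "(p + \<delta>) * v (real k) \<le> (p + \<delta>) * ((1 + \<epsilon>) * v t + (1 + 1/\<epsilon>) * K)"
      using params by (intro mult_left_mono) auto
    then show ?thesis unfolding e_def params(5) by (simp add: algebra_simps)
  qed
  define c where "c = exp ((p + \<delta>) * ((1 + 1/\<epsilon>) * K) + D)"
  have "(\<integral>\<^sup>+\<omega>. (SUP t\<in>{0..}. ennreal (exp (sqrt 2 * X t \<omega> - (1 + b) * v t))) \<partial>M)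
      \<le> (\<integral>\<^sup>+\<omega>. (\<Sum>k. ennreal (e k) * F k \<omega>) \<partial>M)"
  proof (intro nn_integral_mono SUP_least)
    fix \<omega> t assume "\<omega> \<in> space M" "t \<in> {0::real..}"
    define k where "k = nat \<lfloor>t\<rfloor>"
    have t: "t \<in> {real k..real k + 1}" using \<open>t \<in> {0..}\<close> unfolding k_def by auto
    have "ennreal (exp (sqrt 2 * X t \<omega> - (1 + b) * v t))
        = ennreal (exp (- ((1 + b) * v t))) * ennreal (exp (sqrt 2 * X t \<omega>))"
      by (simp flip: ennreal_mult' exp_add)
    also have "\<dots> \<le> ennreal (e k) * F k \<omega>"
      by (intro mult_mono ennreal_leI drift t F \<open>\<omega> \<in> space M\<close>) auto
    also have "\<dots> = (\<Sum>i\<in>{k}. ennreal (e i) * F i \<omega>)" by simp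
    also have "\<dots> \<le> (\<Sum>k. ennreal (e k) * F k \<omega>)"
      by (intro sum_le_suminf) auto
    finally show "ennreal (exp (sqrt 2 * X t \<omega> - (1 + b) * v t)) \<le> (\<Sum>k. ennreal (e k) * F k \<omega>)" .
  qed
  also have "\<dots> = (\<Sum>k. ennreal (e k) * (\<integral>\<^sup>+\<omega>. F k \<omega> \<partial>M))"
    by (simp add: nn_integral_suminf nn_integral_cmult)
  also have "\<dots> \<le> (\<Sum>k. ennreal (c * exp (- \<delta> * v (real k))))"
  proof (intro suminf_le)
    fix k
    have "ennreal (e k) * (\<integral>\<^sup>+\<omega>. F k \<omega> \<partial>M) \<le> ennreal (e k) * ennreal (exp (p * v (real k) + D))"
      by (intro mult_left_mono int_F) simp
    also have "\<dots> = ennreal (c * exp (- \<delta> * v (real k)))"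
      by (simp add: e_def c_def algebra_simps flip: ennreal_mult' exp_add)
    finally show "ennreal (e k) * (\<integral>\<^sup>+\<omega>. F k \<omega> \<partial>M) \<le> ennreal (c * exp (- \<delta> * v (real k)))" .
  qed auto
  also have "\<dots> < \<infinity>"
  proof -
    have "summable (\<lambda>k. c * exp (- \<delta> * v (real k)))" by (intro summable_mult summ params)
    then show ?thesis by (subst suminf_ennreal2) (auto simp: c_def)
  qed
  finally show ?thesis .
qed

text \<open>
  The infimum is bounded below by a measurable function, namely an infimum over dyadic multiples
  of \<open>S\<close>. By compactness this function is positive on every path.
\<close>

lemma nn_integral_INF_drifted_pos:
  assumes r: "0 < r" "r < 1" and geom: "\<And>n. v (1 / 2^n) \<le> C * r^n" and "0 < S" "0 < b"
  shows "0 < (\<integral>\<^sup>+\<omega>. (INF s\<in>{0..S}. ennreal (exp (sqrt 2 * X (- s) \<omega> - (1 + b) * v s))) \<partial>M)"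
proof -
  obtain K where K: "0 \<le> K" "\<And>a t. 0 \<le> a \<Longrightarrow> t \<in> {a..a+1} \<Longrightarrow> v t \<le> 2 * v a + K"
    using variance_le_on_unit_interval[OF r geom] by blast
  define V where "V = 2 * (\<Sum>k\<le>nat \<lfloor>S\<rfloor>. v (real k)) + K"
  have V: "v s \<le> V" if "s \<in> {0..S}" for s
  proof -
    have "s \<in> {real (nat \<lfloor>s\<rfloor>)..real (nat \<lfloor>s\<rfloor>) + 1}" using that by auto
    then have "v s \<le> 2 * v (real (nat \<lfloor>s\<rfloor>)) + K" by (intro K) auto
    moreover have "v (real (nat \<lfloor>s\<rfloor>)) \<le> (\<Sum>k\<le>nat \<lfloor>S\<rfloor>. v (real k))"
      using that by (intro member_le_sum[of "nat \<lfloor>s\<rfloor>" _ "\<lambda>k. v (real k)"])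
        (auto intro!: v_nonneg nat_mono floor_mono)
    ultimately show ?thesis by (simp add: V_def)
  qed
  define h where "h \<omega> = (INF N. INF j\<in>{..(2::nat)^N}. ennreal (exp (sqrt 2 * X (- (S * (real j / 2^N))) \<omega>)))" for \<omega>
  have [measurable]: "h \<in> borel_measurable M" unfolding h_def by measurable
  have h_le: "h \<omega> \<le> ennreal (exp (sqrt 2 * X (- s) \<omega>))" if \<omega>: "\<omega> \<in> space M" and s: "s \<in> {0..S}" for \<omega> s
  proof -
    obtain j where j: "\<And>N. j N \<le> 2^N" "(\<lambda>N. real (j N) / 2^N) \<longlonglongrightarrow> s / S"
      using dyadic_approximation[of "s / S"] s \<open>0 < S\<close> by auto
    have "(\<lambda>N. - (S * (real (j N) / 2^N))) \<longlonglongrightarrow> - (S * (s / S))"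
      by (intro tendsto_intros j(2))
    then have "(\<lambda>N. - (S * (real (j N) / 2^N))) \<longlonglongrightarrow> - s" using \<open>0 < S\<close> by simp
    moreover have "isCont (\<lambda>t. X t \<omega>) (- s)"
      using continuous_path[OF \<omega>] by (simp add: continuous_on_eq_continuous_at)
    ultimately have "(\<lambda>N. X (- (S * (real (j N) / 2^N))) \<omega>) \<longlonglongrightarrow> X (- s) \<omega>"
      by (intro isCont_tendsto_compose[of "- s" "\<lambda>t. X t \<omega>"])
    then have "(\<lambda>N. ennreal (exp (sqrt 2 * X (- (S * (real (j N) / 2^N))) \<omega>)))
        \<longlonglongrightarrow> ennreal (exp (sqrt 2 * X (- s) \<omega>))"
      by (intro tendsto_ennrealI tendsto_exp tendsto_mult tendsto_const)
    moreover have "h \<omega> \<le> ennreal (exp (sqrt 2 * X (- (S * (real (j N) / 2^N))) \<omega>))" for N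
      unfolding h_def using j(1)[of N] by (intro INF_lower2[of N] INF_lower2[of "j N"]) auto
    ultimately show ?thesis by (meson LIMSEQ_le_const)
  qed
  have h_pos: "0 < h \<omega>" if \<omega>: "\<omega> \<in> space M" for \<omega>
  proof -
    have "continuous_on {-S..0} (\<lambda>t. X t \<omega>)"
      using continuous_path[OF \<omega>] by (rule continuous_on_subset) simp
    then have "\<exists>x\<in>{-S..0}. \<forall>y\<in>{-S..0}. X x \<omega> \<le> X y \<omega>"
      using \<open>0 < S\<close> by (intro continuous_attains_inf) auto
    then obtain x where x: "\<And>y. y \<in> {-S..0} \<Longrightarrow> X x \<omega> \<le> X y \<omega>" by blast
    have "0 < ennreal (exp (sqrt 2 * X x \<omega>))" by simp
    also have "\<dots> \<le> h \<omega>"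
      unfolding h_def
    proof (intro INF_greatest ennreal_leI)
      fix N j :: nat assume "j \<in> {..2^N}"
      then have "real j / 2^N \<le> 1" by (simp add: divide_le_eq_1)
      then have "S * (real j / 2^N) \<le> S * 1" using \<open>0 < S\<close> by (intro mult_left_mono) auto
      then have "X x \<omega> \<le> X (- (S * (real j / 2^N))) \<omega>" using \<open>0 < S\<close> by (intro x) auto
      then show "exp (sqrt 2 * X x \<omega>) \<le> exp (sqrt 2 * X (- (S * (real j / 2^N))) \<omega>)" by simp
    qed
    finally show ?thesis .
  qed
  have "(\<integral>\<^sup>+\<omega>. h \<omega> \<partial>M) \<noteq> 0"
  proof
    assume "(\<integral>\<^sup>+\<omega>. h \<omega> \<partial>M) = 0"
    then have "AE \<omega> in M. h \<omega> = 0" by (simp add: nn_integral_0_iff_AE)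
    then have "AE \<omega> in M. False" using AE_space by eventually_elim (use h_pos in force)
    then show False by simp
  qed
  then have "0 < ennreal (exp (- ((1 + b) * V))) * (\<integral>\<^sup>+\<omega>. h \<omega> \<partial>M)"
    by (simp add: ennreal_zero_less_mult_iff zero_less_iff_neq_zero)
  also have "\<dots> = (\<integral>\<^sup>+\<omega>. ennreal (exp (- ((1 + b) * V))) * h \<omega> \<partial>M)"
    by (subst nn_integral_cmult) auto
  also have "\<dots> \<le> (\<integral>\<^sup>+\<omega>. (INF s\<in>{0..S}. ennreal (exp (sqrt 2 * X (- s) \<omega> - (1 + b) * v s))) \<partial>M)"
  proof (intro nn_integral_mono INF_greatest)
    fix \<omega> s assume *: "\<omega> \<in> space M" "s \<in> {0..S}"
    have "exp (- ((1 + b) * V)) \<le> exp (- ((1 + b) * v s))"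
      using V[OF *(2)] \<open>0 < b\<close> by (simp add: mult_left_mono)
    then have "ennreal (exp (- ((1 + b) * V))) * h \<omega>
        \<le> ennreal (exp (- ((1 + b) * v s))) * ennreal (exp (sqrt 2 * X (- s) \<omega>))"
      by (intro mult_mono ennreal_leI h_le *) auto
    also have "\<dots> = ennreal (exp (sqrt 2 * X (- s) \<omega> - (1 + b) * v s))"
      by (simp flip: ennreal_mult' exp_add)
    finally show "ennreal (exp (- ((1 + b) * V))) * h \<omega>
        \<le> ennreal (exp (sqrt 2 * X (- s) \<omega> - (1 + b) * v s))" .
  qed
  finally show ?thesis .
qed

end

section \<open>Gaussian processes with stationary increments\<close>

lemma nn_integral_exp_normal_density:
  assumes "0 < s"
  shows "(\<integral>\<^sup>+x. ennreal (normal_density 0 s x) * ennreal (exp (l * x)) \<partial>lborel) = ennreal (exp (l\<^sup>2 * s\<^sup>2 / 2))"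
proof -
  \<comment> \<open>Completing the square shifts the mean to \<open>l * s\<^sup>2\<close>.\<close>
  have "normal_density 0 s x * exp (l * x) = exp (l\<^sup>2 * s\<^sup>2 / 2) * normal_density (l * s\<^sup>2) s x" for x
  proof -
    have "- (x - 0)\<^sup>2 / (2 * s\<^sup>2) + l * x = l\<^sup>2 * s\<^sup>2 / 2 + - (x - l * s\<^sup>2)\<^sup>2 / (2 * s\<^sup>2)"
      using assms by (simp add: field_simps power2_eq_square)
    then have "exp (- (x - 0)\<^sup>2 / (2 * s\<^sup>2)) * exp (l * x)
        = exp (l\<^sup>2 * s\<^sup>2 / 2) * exp (- (x - l * s\<^sup>2)\<^sup>2 / (2 * s\<^sup>2))"
      by (simp only: flip: exp_add)
    then show ?thesis unfolding normal_density_def by (simp add: ac_simps)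
  qed
  then have "(\<integral>\<^sup>+x. ennreal (normal_density 0 s x) * ennreal (exp (l * x)) \<partial>lborel)
      = (\<integral>\<^sup>+x. ennreal (exp (l\<^sup>2 * s\<^sup>2 / 2)) * ennreal (normal_density (l * s\<^sup>2) s x) \<partial>lborel)"
    by (simp flip: ennreal_mult')
  also have "\<dots> = ennreal (exp (l\<^sup>2 * s\<^sup>2 / 2)) * (\<integral>\<^sup>+x. ennreal (normal_density (l * s\<^sup>2) s x) \<partial>lborel)"
    by (rule nn_integral_cmult) simp
  also have "(\<integral>\<^sup>+x. ennreal (normal_density (l * s\<^sup>2) s x) \<partial>lborel) = 1"
    using assms by (subst nn_integral_eq_integral) (auto intro!: integrable_normal_density)
  finally show ?thesis by simp
qed

lemma (in prob_space) centered_gaussian_mgf: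
  assumes gauss: "gaussian_rv M Y" and mean: "expectation Y = 0"
  shows "(\<integral>\<^sup>+\<omega>. ennreal (exp (l * Y \<omega>)) \<partial>M) = ennreal (exp (l\<^sup>2 * variance Y / 2))"
proof -
  have [measurable]: "Y \<in> borel_measurable M" using gauss by (simp add: gaussian_rv_def)
  consider (degenerate) m where "AE \<omega> in M. Y \<omega> = m"
    | (normal) m s where "0 < s" "distributed M lborel Y (\<lambda>x. ennreal (normal_density m s x))"
    using gauss unfolding gaussian_rv_def by blast
  then show ?thesis
  proof cases
    case degenerate
    have "expectation Y = expectation (\<lambda>_. m)"
      using degenerate by (intro integral_cong_AE) auto
    then have "m = 0" using mean by (simp add: prob_space)
    then have AE_0: "AE \<omega> in M. Y \<omega> = 0" using degenerate by simp
    have "variance Y = expectation (\<lambda>_. 0)"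
      using mean AE_0 by (intro integral_cong_AE) (auto elim: eventually_mono)
    then have "variance Y = 0" by simp
    moreover have "(\<integral>\<^sup>+\<omega>. ennreal (exp (l * Y \<omega>)) \<partial>M) = (\<integral>\<^sup>+\<omega>. 1 \<partial>M)"
      using AE_0 by (intro nn_integral_cong_AE) (auto elim: eventually_mono)
    ultimately show ?thesis by (simp add: emeasure_space_1)
  next
    case normal
    have "m = 0" using normal_distributed_expectation[OF normal] mean by simp
    have var: "variance Y = s\<^sup>2" by (rule normal_distributed_variance[OF normal])
    have "(\<integral>\<^sup>+\<omega>. ennreal (exp (l * Y \<omega>)) \<partial>M)
        = (\<integral>\<^sup>+x. ennreal (normal_density 0 s x) * ennreal (exp (l * x)) \<partial>lborel)"
      using distributed_nn_integral[OF normal(2), of "\<lambda>x. ennreal (exp (l * x))"] \<open>m = 0\<close> by simp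
    with nn_integral_exp_normal_density[OF normal(1)] var show ?thesis by simp
  qed
qed

lemma stationary_increments_nn_integral:
  assumes stat: "stationary_increments M X"
    and [measurable]: "\<And>t. X t \<in> borel_measurable M" "g \<in> borel_measurable borel"
  shows "(\<integral>\<^sup>+\<omega>. g (X (h + u) \<omega> - X h \<omega>) \<partial>M) = (\<integral>\<^sup>+\<omega>. g (X u \<omega> - X 0 \<omega>) \<partial>M)"
proof -
  let ?P = "\<Pi>\<^sub>M t\<in>{u}. borel :: real measure"
  have eq: "(\<integral>\<^sup>+\<omega>. g (X (k + u) \<omega> - X k \<omega>) \<partial>M)
      = (\<integral>\<^sup>+x. g (x u) \<partial>distr M ?P (\<lambda>\<omega>. \<lambda>t\<in>{u}. X (k + t) \<omega> - X k \<omega>))" for k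
    by (subst nn_integral_distr) auto
  have "distr M ?P (\<lambda>\<omega>. \<lambda>t\<in>{u}. X (h + t) \<omega> - X h \<omega>) = distr M ?P (\<lambda>\<omega>. \<lambda>t\<in>{u}. X t \<omega> - X 0 \<omega>)"
    using stat unfolding stationary_increments_def by blast
  with eq[of h] eq[of 0] show ?thesis by simp
qed

lemma stationary_gaussian_incrementsI:
  assumes "prob_space M" and gauss: "gaussian_process M X" and cent: "centered M X"
    and stat: "stationary_increments M X"
    and cont: "\<And>\<omega>. \<omega> \<in> space M \<Longrightarrow> continuous_on UNIV (\<lambda>t. X t \<omega>)"
    and X_0: "AE \<omega> in M. X 0 \<omega> = 0" and v_0: "variance_fun M X 0 = 0"
    and v_pos: "\<And>t. t > 0 \<Longrightarrow> variance_fun M X t > 0"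
  shows "stationary_gaussian_increments M X (variance_fun M X)"
proof -
  interpret prob_space M by fact
  have rv: "gaussian_rv M (X t)" for t
  proof -
    have "gaussian_rv M (\<lambda>\<omega>. \<Sum>i\<in>{t}. 1 * X i \<omega>)"
      using gauss unfolding gaussian_process_def by (elim allE[of _ "{t}"] allE[of _ "\<lambda>_. 1"]) simp
    then show ?thesis by simp
  qed
  have meas [measurable]: "X t \<in> borel_measurable M" for t
    using rv by (simp add: gaussian_rv_def)
  have mean: "expectation (X t) = 0" for t
    using cent by (simp add: centered_def)
  have var: "variance_fun M X t = expectation (\<lambda>\<omega>. (X t \<omega>)\<^sup>2)" for t
    by (simp add: variance_fun_def mean)
  have second_moment: "(\<integral>\<^sup>+\<omega>. ennreal ((X u \<omega>)\<^sup>2) \<partial>M) = ennreal (variance_fun M X u)" if "0 \<le> u" for u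
  proof (cases "u = 0")
    case True
    have "(\<integral>\<^sup>+\<omega>. ennreal ((X 0 \<omega>)\<^sup>2) \<partial>M) = (\<integral>\<^sup>+\<omega>. 0 \<partial>M)"
      using X_0 by (intro nn_integral_cong_AE) (auto elim: eventually_mono)
    with True v_0 show ?thesis by simp
  next
    case False
    \<comment> \<open>The Bochner integral of a function that is not integrable is \<open>0\<close>, which \<open>v_pos\<close> excludes.\<close>
    with that v_pos[of u] var[of u] have "integrable M (\<lambda>\<omega>. (X u \<omega>)\<^sup>2)"
      by (metis not_integrable_integral_eq less_irrefl order_le_less)
    then show ?thesis by (subst nn_integral_eq_integral) (auto simp: var)
  qed
  have drop_X_0: "(\<integral>\<^sup>+\<omega>. g (X (h + u) \<omega> - X h \<omega>) \<partial>M) = (\<integral>\<^sup>+\<omega>. g (X u \<omega>) \<partial>M)"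
    if [measurable]: "g \<in> borel_measurable borel" for g h u
  proof -
    have "(\<integral>\<^sup>+\<omega>. g (X (h + u) \<omega> - X h \<omega>) \<partial>M) = (\<integral>\<^sup>+\<omega>. g (X u \<omega> - X 0 \<omega>) \<partial>M)"
      by (intro stationary_increments_nn_integral stat meas that)
    also have "\<dots> = (\<integral>\<^sup>+\<omega>. g (X u \<omega>) \<partial>M)"
      using X_0 by (intro nn_integral_cong_AE) (auto elim: eventually_mono)
    finally show ?thesis .
  qed
  show ?thesis
  proof
    show "0 \<le> variance_fun M X u" if "0 \<le> u" for u
      using that v_pos[of u] v_0 by (cases "u = 0") auto
    show "(\<integral>\<^sup>+\<omega>. ennreal (exp (l * (X (h + u) \<omega> - X h \<omega>))) \<partial>M)
        = ennreal (exp (l\<^sup>2 * variance_fun M X u / 2))" for h u l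
      using drop_X_0[of "\<lambda>x. ennreal (exp (l * x))" h u] centered_gaussian_mgf[OF rv mean, of l u]
      by (simp add: variance_fun_def)
    show "(\<integral>\<^sup>+\<omega>. ennreal ((X (h + u) \<omega> - X h \<omega>)\<^sup>2) \<partial>M) = ennreal (variance_fun M X u)"
      if "0 \<le> u" for h u
      using drop_X_0[of "\<lambda>x. ennreal (x\<^sup>2)" h u] second_moment[OF that] by simp
  qed (fact meas cont X_0 v_0)+
qed

section \<open>The limit of the truncated constants\<close>

lemma tendsto_SUP_of_mono:
  fixes f :: "real \<Rightarrow> ennreal"
  assumes "mono f"
  shows "(f \<longlongrightarrow> (SUP T. f T)) at_top"
proof (rule order_tendstoI)
  fix a assume "a < (SUP T. f T)"
  then obtain T where "a < f T" by (auto simp: less_SUP_iff)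
  with assms show "\<forall>\<^sub>F T in at_top. a < f T"
    by (auto simp: eventually_at_top_linorder intro!: exI[of _ T] dest: monoD elim: less_le_trans)
next
  fix a assume "(SUP T. f T) < a"
  then show "\<forall>\<^sub>F T in at_top. f T < a"
    by (intro always_eventually allI) (meson SUP_upper UNIV_I le_less_trans)
qed

theorem proposition3p7:
  fixes M :: "'a measure" and X :: "real \<Rightarrow> 'a \<Rightarrow> real"
    and \<alpha>_zero \<alpha>_inf b S :: real
  assumes "prob_space M"
    and "gaussian_process M X"
    and "centered M X"
    and "stationary_increments M X"
    and "\<And>\<omega>. \<omega> \<in> space M \<Longrightarrow> continuous_on UNIV (\<lambda>t. X t \<omega>)"
    and "AE \<omega> in M. X 0 \<omega> = 0"
    and "variance_fun M X 0 = 0"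
    and "\<And>t. t > 0 \<Longrightarrow> variance_fun M X t > 0"
    and A1: "0 < 2 * \<alpha>_inf" "2 * \<alpha>_inf \<le> 2"
      "regularly_varying_at_top (variance_fun M X) (2 * \<alpha>_inf)"
      "variance_fun M X differentiable_on {0<..}"
      "continuous_on {0<..} (deriv (variance_fun M X))"
      "ultimately_monotone (deriv (variance_fun M X))"
    and A2: "0 < 2 * \<alpha>_zero" "2 * \<alpha>_zero < 2"
      "regularly_varying_at_zero (variance_fun M X) (2 * \<alpha>_zero)"
    and "b > 0" and "S > 0"
  shows "\<exists>L. 0 < L \<and> L < \<infinity> \<and>
    ((\<lambda>T. piterbarg_const M X b {0..S} {0..T}) \<longlongrightarrow> L) at_top"
proof -
  let ?v = "variance_fun M X"
  let ?P = "\<lambda>T. piterbarg_const M X b {0..S} {0..T}"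
  let ?f = "\<lambda>t s \<omega>. ennreal (exp (sqrt 2 * X (t - s) \<omega> - (1 + b) * ?v \<bar>t - s\<bar>))"
  interpret stationary_gaussian_increments M X ?v
    by (rule stationary_gaussian_incrementsI) fact+
  obtain C r where r: "0 < r" "r < 1" and geom: "\<And>n. ?v (1 / 2^n) \<le> C * r^n"
    using regularly_varying_at_zero_geometric_bound[OF A2(3,1)] assms(8) by metis
  have "mono ?P"
    unfolding piterbarg_const_def by (intro monoI nn_integral_mono SUP_subset_mono) auto
  then have lim: "(?P \<longlongrightarrow> (SUP T. ?P T)) at_top" by (rule tendsto_SUP_of_mono)
  have "0 < (\<integral>\<^sup>+\<omega>. (INF s\<in>{0..S}. ennreal (exp (sqrt 2 * X (- s) \<omega> - (1 + b) * ?v s))) \<partial>M)"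
    by (rule nn_integral_INF_drifted_pos[OF r geom \<open>S > 0\<close> \<open>b > 0\<close>])
  also have "\<dots> = ?P 0"
    unfolding piterbarg_const_def by (auto intro!: nn_integral_cong INF_cong)
  also have "\<dots> \<le> (SUP T. ?P T)" by (intro SUP_upper) simp
  finally have pos: "0 < (SUP T. ?P T)" .
  have "(SUP T. ?P T) \<le> (\<integral>\<^sup>+\<omega>. (SUP t\<in>{0..}. ennreal (exp (sqrt 2 * X t \<omega> - (1 + b) * ?v t))) \<partial>M)"
    unfolding piterbarg_const_def
  proof (intro SUP_least nn_integral_mono)
    fix T t :: real and \<omega> assume t: "t \<in> {0..T}"
    have "(INF s\<in>{0..S}. ?f t s \<omega>) \<le> ?f t 0 \<omega>"
      using \<open>S > 0\<close> by (intro INF_lower) simp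
    also have "\<dots> = ennreal (exp (sqrt 2 * X t \<omega> - (1 + b) * ?v t))" using t by simp
    also have "\<dots> \<le> (SUP t\<in>{0..}. ennreal (exp (sqrt 2 * X t \<omega> - (1 + b) * ?v t)))"
      using t by (intro SUP_upper) simp
    finally show "(INF s\<in>{0..S}. ?f t s \<omega>)
        \<le> (SUP t\<in>{0..}. ennreal (exp (sqrt 2 * X t \<omega> - (1 + b) * ?v t)))" .
  qed
  also have "\<dots> < \<infinity>"
    using summable_exp_minus_regularly_varying[OF A1(3,1) assms(8) A1(4,6)]
    by (intro nn_integral_SUP_drifted_finite[OF r geom _ \<open>b > 0\<close>]) auto
  finally show ?thesis using lim pos by blast
qed

end
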